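(* Let $\mathcal U$ be a risk frontier and let $\Phi_{T+1}\in\mathcal L_{T+1}$ be a fixed terminal input. Suppose there exist correspondences $\mathcal U_t:\mathbb H_t\times\mathcal L_{t+1}\rightrightarrows\mathcal L_{t+1}\times\mathbb R\times\mathbb R$, $t\in[T]$, such that: (a) $\mathcal U=\{(X_{0:T},Z_{0:T},\Phi_{0:T}):[(X_t,Z_t,\Phi_t)\mid h_t]\in\mathcal U_t(h_t,\Phi_{t+1}),\ \forall h_t\in\mathbb H_t,\ \forall t\in[T]\}$; (b) for any $t\in[T]$, $h_t\in\mathbb H_t$, $\Phi_{t+1}\in\mathcal L_{t+1}$, if $(X_t,z_t,\varphi_t)\in\mathcal U_t(h_t,\Phi_{t+1})$ and $X_t\le X'_t$ then $(X'_t,z_t,\varphi_t)\in\mathcal U_t(h_t,\Phi_{t+1})$; (c) for any $\Phi_{t+1}\le\Phi'_{t+1}$, $\mathcal U_t(h_t,\Phi'_{t+1})\subset\mathcal U_t(h_t,\Phi_{t+1})$ for all $h_t\in\mathbb H_t$. Let $\{\varrho_{\mathcal U,t:T}\}_{t\in[T]}$ be the induced dynamic risk measure, with $\varrho_{\mathcal U,T+1:T}\equiv\Phi_{T+1}$. Then: (i) For any $t\in[T]$ and $X_{t:T}\in\mathcal L_{t+1:T+1}$, $$[\varrho_{\mathcal U,t:T}(X_{t:T})](h_t)=\min_{z_t,\varphi_t}\{\varphi_t:([X_t\mid h_t],z_t,\varphi_t)\in\mathcal U_t(h_t,\varrho_{\mathcal U,t+1:T}(X_{t+1:T}))\},\quad\forall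 h_t\in\mathbb H_t.$$ (ii) $\{\varrho_{\mathcal U,t:T}\}_{t\in[T]}$ is time-consistent: for all $0\le t_1<t_2\le T$ and all $X_{t_1:T},Y_{t_1:T}\in\mathcal L_{t_1+1:T+1}$, the conditions $X_k=Y_k$ for $k\in[t_1,t_2-1]$ and $\varrho_{\mathcal U,t_2:T}(X_{t_2:T})\le\varrho_{\mathcal U,t_2:T}(Y_{t_2:T})$ imply $\varrho_{\mathcal U,t_1:T}(X_{t_1:T})\le\varrho_{\mathcal U,t_1:T}(Y_{t_1:T})$.
   Context: Notation: $[n]=\{0,1,\dots,n\}$, $[n_1,n_2]=\{n_1,\dots,n_2\}$. Fix a horizon $0\le T<\infty$. The data space $\Xi$ and state space $\mathbb S$ are finite, the initial state $s_0\in\mathbb S$ is fixed, and states evolve by $s_{t+1}=f_t(s_t,\xi_t)$ with $f_t:\mathbb S\times\Xi\to\mathbb S$, $t\in[T-1]$. $\Omega$ is the finite set of trajectories $\omega=(s_0,\xi_0,\dots,\xi_T)$, with a probability measure $\mathbb P$. For $t\in[T+1]$, $h_t=(s_0,\xi_0,\dots,\xi_{t-1})$ is the history up to the beginning of period $t$, $\mathbb H_t$ is the set of such histories, $\mathscr F_t=\sigma(h_t)$, and $\mathcal L_t=\mathcal L^\infty(\Omega,\mathscr F_t,\mathbb P)$. Put $\mathcal L_{t:T}=\prod_{k=t}^{T}\mathcal L_k$ and $\mathcal L_{t+1:T+1}=\prod_{k=t+1}^{T+1}\mathcal L_k$. A (tail) payoff stream is $X_{t:T}\in\mathcal L_{t+1:T+1}$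 with $X_k\in\mathcal L_{k+1}$; a (tail) disbursement strategy is $Z_{t:T}\in\mathcal L_{t:T}$ and a (tail) premium schedule is $\Phi_{t:T}\in\mathcal L_{t:T}$, with $Z_k,\Phi_k\in\mathcal L_k$. $\Phi_0$ is a constant, denoted $\varphi_0$. Inequalities hold componentwise and almost surely. $[X\mid h_t]$ denotes the conditional random variable $X$ given the history $h_t$; for $\mathscr F_t$-measurable $Z_t$, $[Z_t\mid h_t]$ is the number $Z_t(h_t)$. The decision maker has perfect recall: $h_t$ determines the past values $(X_{0:t-1},Z_{0:t-1},\Phi_{0:t-1})$. Risk frontier: a set $\mathcal U\subset\mathcal L_{1:T+1}\times\mathcal L_{0:T}\times\mathcal L_{0:T}$ is a risk frontier if: (i) $(X_{0:T},Z_{0:T},\Phi_{0:T})\in\mathcal U$ implies $(X'_{0:T},Z_{0:T},\Phi_{0:T})\in\mathcal U$ for all $X'_{0:T}\ge X_{0:T}$; (ii) $(X_{0:T},Z_{0:T},\Phi_{0:T})\in\mathcal U$ implies $(X_{0:T},Z_{0:T},\Phi_{0:T}+\Phi'_{0:T})\in\mathcal U$ for all non-increasing processes $\Phi'_{0:T}\ge 0$, i.e. $\Phi'_t(h_t)\ge\mathbb E[\Phi'_{t+1}\mid h_t]$ for all $h_t\in\mathbb H_t$ and $t\in[T-1]$; (iii) $(X_{0:T},Z_{0:T},\Phi_{0:T})\in\mathcal U$ and $Z'_{0:T}\ge Z_{0:T}$ imply $(X_{0:T},Z'_{0:T},\Phi'_{0:T})\in\mathcal U$ for some $\Phi'_{0:T}\ge\Phi_{0:T}$;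 (iv) $\mathcal U$ is closed. Induced dynamic risk measure: for $t\in[T]$, $\varrho_{\mathcal U,t:T}:\mathcal L_{t+1:T+1}\to\mathcal L_t$ is $$[\varrho_{\mathcal U,t:T}(X_{t:T})](h_t)=\min_{Z_{t:T},\Phi_{t:T}}\{\Phi_t(h_t):[(X_k,Z_k,\Phi_k)\mid h_k]\in\mathcal U_k(h_k,\Phi_{k+1}),\ \forall h_k\in\mathbb H_k,\ \forall k\in[t,T]\},\quad h_t\in\mathbb H_t,$$ with $\Phi_{T+1}$ the fixed terminal input (the constraints define the tail risk frontier for periods $[t,T]$). The minima are understood to exist (the map takes values in $\mathcal L_t$). *)

theory Defs
  imports "HOL-Probability.Probability"
begin

text \<open>
  A trajectory \<open>(s\<^sub>0, [\<xi>\<^sub>0, \<dots>, \<xi>\<^sub>T])\<close> and its histories \<open>(s\<^sub>0, [\<xi>\<^sub>0, \<dots>, \<xi>\<^sub>t\<^sub>-\<^sub>1])\<close> share one type.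
  The states \<open>s\<^sub>1, s\<^sub>2, \<dots>\<close> obtained from the transition maps \<open>f\<^sub>t\<close> are functions of the history,
  so they carry no information beyond it and the transition maps do not occur below.
\<close>

type_synonym ('s, 'x) traj = "'s \<times> 'x list"
type_synonym ('s, 'x) rv = "('s, 'x) traj \<Rightarrow> real"
type_synonym ('s, 'x) process = "nat \<Rightarrow> ('s, 'x) rv"

definition trajectories :: "'s \<Rightarrow> nat \<Rightarrow> ('s, 'x) traj set" where
  "trajectories s0 T = {(s0, xs) | xs. length xs = T + 1}"

definition scenario_model :: "'s::finite \<Rightarrow> nat \<Rightarrow> ('s, 'x::finite) traj measure \<Rightarrow> bool" where
  "scenario_model s0 T M \<longleftrightarrow>
     prob_space M \<and> space M = trajectories s0 T \<and> sets M = Pow (trajectories s0 T)"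

definition hist :: "nat \<Rightarrow> ('s, 'x) traj \<Rightarrow> ('s, 'x) traj" where
  "hist t \<omega> = (fst \<omega>, take t (snd \<omega>))"

text \<open>
  Random variables are identified up to almost sure equality, so conditioning on a history and
  evaluating at a history make sense only for histories of positive probability.
\<close>

definition histories :: "('s, 'x) traj measure \<Rightarrow> nat \<Rightarrow> ('s, 'x) traj set" where
  "histories M t = {h. measure M {\<omega> \<in> space M. hist t \<omega> = h} > 0}"

definition past :: "('s, 'x) traj measure \<Rightarrow> nat \<Rightarrow> ('s, 'x) traj measure" where
  "past M t = vimage_algebra (space M) (hist t) (count_space UNIV)"

text \<open>Elements of \<open>L\<^sup>\<infinity>\<close> are given by representatives; all (in)equalities between them are almost sure.\<close>

definition Linf :: "('s, 'x) traj measure \<Rightarrow> nat \<Rightarrow> ('s, 'x) rv set" where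
  "Linf M t = {X \<in> borel_measurable (past M t). \<exists>C. AE \<omega> in M. \<bar>X \<omega>\<bar> \<le> C}"

definition le_as :: "('s, 'x) traj measure \<Rightarrow> ('s, 'x) rv \<Rightarrow> ('s, 'x) rv \<Rightarrow> bool" where
  "le_as M X Y \<longleftrightarrow> (AE \<omega> in M. X \<omega> \<le> Y \<omega>)"

definition eq_as :: "('s, 'x) traj measure \<Rightarrow> ('s, 'x) rv \<Rightarrow> ('s, 'x) rv \<Rightarrow> bool" where
  "eq_as M X Y \<longleftrightarrow> (AE \<omega> in M. X \<omega> = Y \<omega>)"

text \<open>A variable measurable with respect to the history up to \<open>t\<close> is constant on each set below.\<close>

definition at_hist :: "('s, 'x) traj measure \<Rightarrow> nat \<Rightarrow> ('s, 'x) rv \<Rightarrow> ('s, 'x) traj \<Rightarrow> real" where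
  "at_hist M t Z h = (THE c. \<forall>\<omega>\<in>space M. hist t \<omega> = h \<longrightarrow> Z \<omega> = c)"

text \<open>
  The conditional variable \<open>[X | h\<^sub>t]\<close> is \<open>X\<close> on the trajectories that continue \<open>h\<^sub>t\<close>. It is viewed as
  an element of the same \<open>L\<^sup>\<infinity>\<close> space as \<open>X\<close> through extension by zero.
\<close>

definition cond_rv :: "nat \<Rightarrow> ('s, 'x) rv \<Rightarrow> ('s, 'x) traj \<Rightarrow> ('s, 'x) rv" where
  "cond_rv t X h = (\<lambda>\<omega>. if hist t \<omega> = h then X \<omega> else 0)"

text \<open>Payoff streams are indexed by \<open>k \<in> {t..T}\<close> with \<open>X k\<close> measurable at the end of period \<open>k\<close>.\<close>

definition payoffs :: "('s, 'x) traj measure \<Rightarrow> nat \<Rightarrow> nat \<Rightarrow> ('s, 'x) process set" where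
  "payoffs M t T = PiE {t..T} (\<lambda>k. Linf M (k + 1))"

definition strategies :: "('s, 'x) traj measure \<Rightarrow> nat \<Rightarrow> nat \<Rightarrow> ('s, 'x) process set" where
  "strategies M t T = PiE {t..T} (\<lambda>k. Linf M k)"

definition tail :: "nat \<Rightarrow> nat \<Rightarrow> ('s, 'x) process \<Rightarrow> ('s, 'x) process" where
  "tail t T X = restrict X {t..T}"

definition proc_le :: "('s, 'x) traj measure \<Rightarrow> nat \<Rightarrow> ('s, 'x) process \<Rightarrow> ('s, 'x) process \<Rightarrow> bool" where
  "proc_le M T X Y \<longleftrightarrow> (\<forall>k\<le>T. le_as M (X k) (Y k))"

definition proc_add :: "nat \<Rightarrow> ('s, 'x) process \<Rightarrow> ('s, 'x) process \<Rightarrow> ('s, 'x) process" where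
  "proc_add T X Y = (\<lambda>k\<in>{0..T}. \<lambda>\<omega>. X k \<omega> + Y k \<omega>)"

definition nonincreasing :: "('s, 'x) traj measure \<Rightarrow> nat \<Rightarrow> ('s, 'x) process \<Rightarrow> bool" where
  "nonincreasing M T \<Phi> \<longleftrightarrow>
     (\<forall>t<T. \<forall>h\<in>histories M t.
        at_hist M t (\<Phi> t) h \<ge> at_hist M t (real_cond_exp M (past M t) (\<Phi> (t + 1))) h)"

definition proc_near :: "('s, 'x) traj measure \<Rightarrow> nat \<Rightarrow> ereal \<Rightarrow> ('s, 'x) process \<Rightarrow> ('s, 'x) process \<Rightarrow> bool" where
  "proc_near M T \<epsilon> X Y \<longleftrightarrow> (\<forall>k\<le>T. esssup M (\<lambda>\<omega>. ereal \<bar>X k \<omega> - Y k \<omega>\<bar>) < \<epsilon>)"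

text \<open>Closedness in the product of the \<open>L\<^sup>\<infinity>\<close> norms: every adherent point belongs to the set.\<close>

definition closed_Linf ::
  "('s, 'x) traj measure \<Rightarrow> nat \<Rightarrow> (('s, 'x) process \<times> ('s, 'x) process \<times> ('s, 'x) process) set \<Rightarrow> bool" where
  "closed_Linf M T U \<longleftrightarrow>
     (\<forall>X\<in>payoffs M 0 T. \<forall>Z\<in>strategies M 0 T. \<forall>\<Phi>\<in>strategies M 0 T.
        (\<forall>\<epsilon>>0. \<exists>(X', Z', \<Phi>')\<in>U. proc_near M T \<epsilon> X' X \<and> proc_near M T \<epsilon> Z' Z \<and> proc_near M T \<epsilon> \<Phi>' \<Phi>)
        \<longrightarrow> (X, Z, \<Phi>) \<in> U)"

definition risk_frontier ::
  "('s, 'x) traj measure \<Rightarrow> nat \<Rightarrow> (('s, 'x) process \<times> ('s, 'x) process \<times> ('s, 'x) process) set \<Rightarrow> bool" where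
  "risk_frontier M T U \<longleftrightarrow>
     U \<subseteq> payoffs M 0 T \<times> strategies M 0 T \<times> strategies M 0 T \<and>
     (\<forall>X Z \<Phi>. (X, Z, \<Phi>) \<in> U \<longrightarrow>
        (\<forall>X'\<in>payoffs M 0 T. proc_le M T X X' \<longrightarrow> (X', Z, \<Phi>) \<in> U)) \<and>
     (\<forall>X Z \<Phi>. (X, Z, \<Phi>) \<in> U \<longrightarrow>
        (\<forall>\<Phi>'\<in>strategies M 0 T.
           proc_le M T (\<lambda>_ _. 0) \<Phi>' \<and> nonincreasing M T \<Phi>' \<longrightarrow> (X, Z, proc_add T \<Phi> \<Phi>') \<in> U)) \<and>
     (\<forall>X Z \<Phi>. (X, Z, \<Phi>) \<in> U \<longrightarrow>
        (\<forall>Z'\<in>strategies M 0 T. proc_le M T Z Z' \<longrightarrow>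
           (\<exists>\<Phi>'\<in>strategies M 0 T. proc_le M T \<Phi> \<Phi>' \<and> (X, Z', \<Phi>') \<in> U))) \<and>
     closed_Linf M T U"

text \<open>
  A family of correspondences \<open>\<U>\<^sub>t\<close> maps a period, a history and an element of \<open>\<L>\<^sub>t\<^sub>+\<^sub>1\<close> to a set of
  triples. The argument \<open>\<Psi>\<close> is the terminal input \<open>\<Phi>\<^sub>T\<^sub>+\<^sub>1\<close>.
\<close>

type_synonym ('s, 'x) correspondence =
  "nat \<Rightarrow> ('s, 'x) traj \<Rightarrow> ('s, 'x) rv \<Rightarrow> (('s, 'x) rv \<times> real \<times> real) set"

definition correspondences :: "('s, 'x) traj measure \<Rightarrow> nat \<Rightarrow> ('s, 'x) correspondence \<Rightarrow> bool" where
  "correspondences M T Ut \<longleftrightarrow>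
     (\<forall>t\<le>T. \<forall>h\<in>histories M t. \<forall>\<Phi>\<in>Linf M (t + 1). Ut t h \<Phi> \<subseteq> Linf M (t + 1) \<times> UNIV \<times> UNIV)"

definition tail_frontier ::
  "('s, 'x) traj measure \<Rightarrow> nat \<Rightarrow> ('s, 'x) rv \<Rightarrow> ('s, 'x) correspondence \<Rightarrow> nat \<Rightarrow>
   (('s, 'x) process \<times> ('s, 'x) process \<times> ('s, 'x) process) set" where
  "tail_frontier M T \<Psi> Ut t =
     {(X, Z, \<Phi>). X \<in> payoffs M t T \<and> Z \<in> strategies M t T \<and> \<Phi> \<in> strategies M t T \<and>
        (\<forall>k\<in>{t..T}. \<forall>h\<in>histories M k.
           (cond_rv k (X k) h, at_hist M k (Z k) h, at_hist M k (\<Phi> k) h)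
             \<in> Ut k h (if k = T then \<Psi> else \<Phi> (k + 1)))}"

definition is_minimum :: "real set \<Rightarrow> real \<Rightarrow> bool" where
  "is_minimum A m \<longleftrightarrow> m \<in> A \<and> (\<forall>a\<in>A. m \<le> a)"

definition premiums ::
  "('s, 'x) traj measure \<Rightarrow> nat \<Rightarrow> ('s, 'x) rv \<Rightarrow> ('s, 'x) correspondence \<Rightarrow> nat \<Rightarrow>
   ('s, 'x) process \<Rightarrow> ('s, 'x) traj \<Rightarrow> real set" where
  "premiums M T \<Psi> Ut t X h = {at_hist M t (\<Phi> t) h | Z \<Phi>. (X, Z, \<Phi>) \<in> tail_frontier M T \<Psi> Ut t}"

definition minima_exist ::
  "('s, 'x) traj measure \<Rightarrow> nat \<Rightarrow> ('s, 'x) rv \<Rightarrow> ('s, 'x) correspondence \<Rightarrow> bool" where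
  "minima_exist M T \<Psi> Ut \<longleftrightarrow>
     (\<forall>t\<le>T. \<forall>X\<in>payoffs M t T. \<forall>h\<in>histories M t. \<exists>m. is_minimum (premiums M T \<Psi> Ut t X h) m)"

definition risk_measure ::
  "('s, 'x) traj measure \<Rightarrow> nat \<Rightarrow> ('s, 'x) rv \<Rightarrow> ('s, 'x) correspondence \<Rightarrow> nat \<Rightarrow>
   ('s, 'x) process \<Rightarrow> ('s, 'x) rv" where
  "risk_measure M T \<Psi> Ut t X =
     (if t = T + 1 then \<Psi>
      else (\<lambda>\<omega>. THE m. is_minimum (premiums M T \<Psi> Ut t X (hist t \<omega>)) m))"

definition time_consistent ::
  "('s, 'x) traj measure \<Rightarrow> nat \<Rightarrow> (nat \<Rightarrow> ('s, 'x) process \<Rightarrow> ('s, 'x) rv) \<Rightarrow> bool" where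
  "time_consistent M T \<rho> \<longleftrightarrow>
     (\<forall>t1 t2. t1 < t2 \<and> t2 \<le> T \<longrightarrow>
        (\<forall>X\<in>payoffs M t1 T. \<forall>Y\<in>payoffs M t1 T.
           (\<forall>k\<in>{t1..<t2}. eq_as M (X k) (Y k)) \<and>
           le_as M (\<rho> t2 (tail t2 T X)) (\<rho> t2 (tail t2 T Y)) \<longrightarrow>
           le_as M (\<rho> t1 X) (\<rho> t1 Y)))"

end

theory Submission
  imports Defs
begin

text \<open>
  The correspondence at a history may depend on the whole next premium, also off that history, so
  optimal strategies for different histories cannot simply be pasted together. Instead, by
  antimonotonicity in the premium input, the feasible pairs are closed under taking the pointwise
  smaller premium together with the disbursement that goes with it. Since there are finitely many
  histories, one feasible pair attains the minimum at all of them at once, and its premium is the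
  risk measure. Feasible tails from \<open>t\<close> are then one-step choices in front of such an optimal tail
  from \<open>t + 1\<close>, which is (i); (ii) follows from (i) by backward induction.
\<close>

section \<open>Random variables and histories on the finite trajectory space\<close>

locale scenarios =
  fixes s0 :: "'s::finite" and T :: nat and M :: "('s, 'x::finite) traj measure"
  assumes model: "scenario_model s0 T M"
begin

sublocale prob_space M
  using model by (simp add: scenario_model_def)

lemma sets_M: "sets M = Pow (space M)"
  using model by (simp add: scenario_model_def)

lemma finite_space: "finite (space M)"
proof -
  have "space M = Pair s0 ` {xs. set xs \<subseteq> UNIV \<and> length xs = T + 1}"
    using model by (auto simp: scenario_model_def trajectories_def)
  then show ?thesis
    using finite_lists_length_eq[of "UNIV :: 'x set" "T + 1"] by simp
qed

lemma space_past [simp]: "space (past M t) = space M"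
  by (simp add: past_def)

text \<open>The events of \<open>past M t\<close> are exactly the preimages under
  \<open>hist t\<close>, and boundedness is automatic on a finite space. Constancy on fibres holds
  pointwise, also on null ones, so measurability of combined strategies can be checked trajectory by
  trajectory.\<close>

lemma Linf_iff:
  "X \<in> Linf M t \<longleftrightarrow>
     (\<forall>\<omega>\<in>space M. \<forall>\<omega>'\<in>space M. hist t \<omega> = hist t \<omega>' \<longrightarrow> X \<omega> = X \<omega>')"
proof
  assume "X \<in> Linf M t"
  then have meas: "X \<in> borel_measurable (past M t)"
    by (simp add: Linf_def)
  show "\<forall>\<omega>\<in>space M. \<forall>\<omega>'\<in>space M. hist t \<omega> = hist t \<omega>' \<longrightarrow> X \<omega> = X \<omega>'"
  proof (intro ballI impI)
    fix \<omega> \<omega>' assume \<omega>: "\<omega> \<in> space M" "\<omega>' \<in> space M" "hist t \<omega> = hist t \<omega>'"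
    have "X -` {X \<omega>} \<inter> space M \<in> sets (past M t)"
      using measurable_sets[OF meas, of "{X \<omega>}"] by simp
    then obtain A where "X -` {X \<omega>} \<inter> space M = hist t -` A \<inter> space M"
      unfolding past_def by (subst (asm) sets_vimage_algebra2) auto
    then have "\<omega>'' \<in> X -` {X \<omega>} \<inter> space M \<longleftrightarrow> \<omega>'' \<in> hist t -` A \<inter> space M" for \<omega>'' by simp
    from this[of \<omega>] this[of \<omega>'] \<omega> show "X \<omega> = X \<omega>'" by simp
  qed
next
  assume const: "\<forall>\<omega>\<in>space M. \<forall>\<omega>'\<in>space M. hist t \<omega> = hist t \<omega>' \<longrightarrow> X \<omega> = X \<omega>'"
  \<comment> \<open>Factor \<open>X\<close> through \<open>hist t\<close> by choosing one trajectory
    in each fibre.\<close>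
  define g where "g h = X (SOME \<omega>. \<omega> \<in> space M \<and> hist t \<omega> = h)" for h
  have g: "X \<omega> = g (hist t \<omega>)" if "\<omega> \<in> space M" for \<omega>
  proof -
    have "\<exists>\<omega>'. \<omega>' \<in> space M \<and> hist t \<omega>' = hist t \<omega>" using that by blast
    from someI_ex[OF this] const that show ?thesis unfolding g_def by metis
  qed
  have "hist t \<in> measurable (past M t) (count_space UNIV)"
    unfolding past_def by (rule measurable_vimage_algebra1) auto
  then have "(\<lambda>\<omega>. g (hist t \<omega>)) \<in> borel_measurable (past M t)"
    by (rule measurable_compose) simp
  then have "X \<in> borel_measurable (past M t)"
    by (rule measurable_cong[THEN iffD1, rotated]) (simp add: g)
  moreover have "AE \<omega> in M. \<bar>X \<omega>\<bar> \<le> Max ((\<lambda>\<omega>. \<bar>X \<omega>\<bar>) ` space M)"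
    using finite_space by (intro AE_I2) auto
  ultimately show "X \<in> Linf M t" unfolding Linf_def by blast
qed

lemma Linf_const: "X \<omega> = X \<omega>'"
  if "X \<in> Linf M t" "\<omega> \<in> space M" "\<omega>' \<in> space M" "hist t \<omega> = hist t \<omega>'"
  using that unfolding Linf_iff by blast

lemma at_hist_hist: "at_hist M t X (hist t \<omega>) = X \<omega>"
  if "X \<in> Linf M t" "\<omega> \<in> space M"
  unfolding at_hist_def using that Linf_const by (intro the_equality) blast+

lemma hist_Suc_eqD: "hist (Suc t) \<omega> = hist (Suc t) \<omega>' \<Longrightarrow> hist t \<omega> = hist t \<omega>'"
  unfolding hist_def by (metis Pair_inject min.absorb1 order.refl le_SucI fst_conv snd_conv take_take)

lemma cond_rv_Linf: "X \<in> Linf M (t + 1) \<Longrightarrow> cond_rv t X h \<in> Linf M (t + 1)"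
  unfolding Linf_iff cond_rv_def by (metis hist_Suc_eqD Suc_eq_plus1)

text \<open>The fibre of such a history has positive mass, so an almost sure property cannot fail on
  all of it.\<close>

lemma histories_AE:
  assumes "h \<in> histories M t" "AE \<omega> in M. P \<omega>"
  obtains \<omega> where "\<omega> \<in> space M" "hist t \<omega> = h" "P \<omega>"
proof (rule ccontr)
  assume "\<not> thesis"
  then have no: "\<not> (\<omega> \<in> space M \<and> hist t \<omega> = h \<and> P \<omega>)" for \<omega>
    using that by blast
  from assms(2) have "AE \<omega> in M. \<omega> \<notin> {\<omega> \<in> space M. hist t \<omega> = h}"
    by eventually_elim (use no in blast)
  then have "prob {\<omega> \<in> space M. hist t \<omega> = h} = 0"
    by (subst prob_eq_0) (auto simp: sets_M)
  with assms(1) show False by (simp add: histories_def)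
qed

lemma histories_obtain:
  assumes "h \<in> histories M t"
  obtains \<omega> where "\<omega> \<in> space M" "hist t \<omega> = h"
  by (rule histories_AE[OF assms, of "\<lambda>_. True"]) auto

text \<open>Each remaining history has a null fibre, and only finitely many histories occur, so
  these null sets may be united.\<close>

lemma AE_histories: "AE \<omega> in M. hist t \<omega> \<in> histories M t"
proof -
  have "AE \<omega> in M. hist t \<omega> = h \<longrightarrow> h \<in> histories M t" for h
  proof (cases "h \<in> histories M t")
    case False
    then have "prob {\<omega> \<in> space M. hist t \<omega> = h} = 0"
      by (simp add: histories_def order.antisym[OF _ measure_nonneg] not_less)
    then have "AE \<omega> in M. \<omega> \<notin> {\<omega> \<in> space M. hist t \<omega> = h}"
      by (subst (asm) prob_eq_0) (auto simp: sets_M)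
    with AE_space show ?thesis by eventually_elim auto
  qed simp
  then have "AE \<omega> in M. \<forall>h\<in>hist t ` space M. hist t \<omega> = h \<longrightarrow> h \<in> histories M t"
    using finite_space by (intro AE_finite_allI) auto
  with AE_space show ?thesis by eventually_elim auto
qed

lemma le_asI:
  assumes "\<And>\<omega>. \<omega> \<in> space M \<Longrightarrow> hist t \<omega> \<in> histories M t \<Longrightarrow> X \<omega> \<le> Y \<omega>"
  shows "le_as M X Y"
  unfolding le_as_def using AE_space AE_histories[of t] by eventually_elim (rule assms)

lemma finite_histories: "finite (histories M t)"
proof (rule finite_subset)
  show "histories M t \<subseteq> hist t ` space M" by (blast elim: histories_obtain)
qed (use finite_space in simp)

text \<open>The total mass is one. Nonemptiness provides the first feasible pair of the induction in
  \<open>optimal_on_finite\<close>.\<close>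

lemma histories_nonempty: "histories M t \<noteq> {}"
proof
  assume "histories M t = {}"
  with AE_histories[of t] have "AE \<omega> in M. False" by simp
  then show False by (simp add: AE_False)
qed

end

section \<open>Minima of sets of reals and tails of streams\<close>

lemma is_minimum_unique: "is_minimum A m \<Longrightarrow> is_minimum A m' \<Longrightarrow> m = m'"
  by (force simp: is_minimum_def intro: order.antisym)

lemma is_minimum_antimono: "is_minimum A m \<Longrightarrow> is_minimum B m' \<Longrightarrow> B \<subseteq> A \<Longrightarrow> m \<le> m'"
  by (auto simp: is_minimum_def)

lemma tail_payoffs: "X \<in> payoffs M t T \<Longrightarrow> t \<le> t' \<Longrightarrow> tail t' T X \<in> payoffs M t' T"
  by (auto simp: payoffs_def tail_def PiE_iff)

lemma tail_payoffs_same: "X \<in> payoffs M t T \<Longrightarrow> tail t T X = X"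
  by (simp add: payoffs_def tail_def PiE_restrict)

lemma tail_tail: "t \<le> t' \<Longrightarrow> tail t' T (tail t T X) = tail t' T X"
  by (auto simp: tail_def restrict_def)

section \<open>Feasible tails and their premiums\<close>

locale decomposed_frontier = scenarios s0 T M
  for s0 :: "'s::finite" and T and M :: "('s, 'x::finite) traj measure" +
  fixes \<Psi> :: "('s, 'x) rv" and Ut :: "('s, 'x) correspondence"
  assumes terminal: "\<Psi> \<in> Linf M (T + 1)"
    and mono_payoff: "\<lbrakk>t \<le> T; h \<in> histories M t; \<Phi> \<in> Linf M (t + 1);
        X \<in> Linf M (t + 1); X' \<in> Linf M (t + 1);
        (X, z, \<phi>) \<in> Ut t h \<Phi>; le_as M X X'\<rbrakk> \<Longrightarrow> (X', z, \<phi>) \<in> Ut t h \<Phi>"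
    and antimono_premium: "\<lbrakk>t \<le> T; h \<in> histories M t;
        \<Phi> \<in> Linf M (t + 1); \<Phi>' \<in> Linf M (t + 1); le_as M \<Phi> \<Phi>'\<rbrakk> \<Longrightarrow> Ut t h \<Phi>' \<subseteq> Ut t h \<Phi>"
    and minima: "minima_exist M T \<Psi> Ut"
begin

definition next_premium :: "nat \<Rightarrow> ('s, 'x) process \<Rightarrow> ('s, 'x) rv" where
  "next_premium k \<Phi> = (if k = T then \<Psi> else \<Phi> (k + 1))"

definition feasible :: "nat \<Rightarrow> ('s, 'x) process \<Rightarrow> ('s, 'x) process \<Rightarrow> ('s, 'x) process \<Rightarrow> bool" where
  "feasible t X Z \<Phi> \<longleftrightarrow> (X, Z, \<Phi>) \<in> tail_frontier M T \<Psi> Ut t"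

abbreviation \<rho> :: "nat \<Rightarrow> ('s, 'x) process \<Rightarrow> ('s, 'x) rv" where
  "\<rho> \<equiv> risk_measure M T \<Psi> Ut"

lemma strategiesD: "\<Phi> \<in> strategies M t T \<Longrightarrow> k \<in> {t..T} \<Longrightarrow> \<Phi> k \<in> Linf M k"
  by (auto simp: strategies_def)

lemma payoffsD: "X \<in> payoffs M t T \<Longrightarrow> k \<in> {t..T} \<Longrightarrow> X k \<in> Linf M (k + 1)"
  unfolding payoffs_def by (rule PiE_mem)

lemma next_premium_Linf:
  "\<Phi> \<in> strategies M t T \<Longrightarrow> k \<in> {t..T} \<Longrightarrow> next_premium k \<Phi> \<in> Linf M (k + 1)"
  using terminal by (auto simp: next_premium_def intro: strategiesD)

text \<open>A history of positive probability is \<open>hist k \<omega>\<close> for some trajectory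
  \<omega>, and there \<open>at_hist\<close> is an ordinary function value. This lets the argument
  work with trajectories instead of histories.\<close>

lemma feasible_iff:
  "feasible t X Z \<Phi> \<longleftrightarrow> X \<in> payoffs M t T \<and> Z \<in> strategies M t T \<and> \<Phi> \<in> strategies M t T \<and>
     (\<forall>k\<in>{t..T}. \<forall>\<omega>\<in>space M. hist k \<omega> \<in> histories M k \<longrightarrow>
        (cond_rv k (X k) (hist k \<omega>), Z k \<omega>, \<Phi> k \<omega>) \<in> Ut k (hist k \<omega>) (next_premium k \<Phi>))"
  (is "?L \<longleftrightarrow> ?R")
proof
  assume L: ?L
  then have Z: "Z \<in> strategies M t T" and \<Phi>: "\<Phi> \<in> strategies M t T"
    by (auto simp: feasible_def tail_frontier_def)
  show ?R
    using L strategiesD[OF Z] strategiesD[OF \<Phi>] at_hist_hist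
    unfolding feasible_def tail_frontier_def next_premium_def by fastforce
next
  assume R: ?R
  have "(cond_rv k (X k) h, at_hist M k (Z k) h, at_hist M k (\<Phi> k) h)
      \<in> Ut k h (if k = T then \<Psi> else \<Phi> (k + 1))" if k: "k \<in> {t..T}" and h: "h \<in> histories M k" for k h
  proof -
    obtain \<omega> where \<omega>: "\<omega> \<in> space M" "hist k \<omega> = h" using h by (rule histories_obtain)
    have "at_hist M k (Z k) h = Z k \<omega>" "at_hist M k (\<Phi> k) h = \<Phi> k \<omega>"
      using R k \<omega> at_hist_hist[OF strategiesD, of _ t k \<omega>] by auto
    moreover have "(cond_rv k (X k) h, Z k \<omega>, \<Phi> k \<omega>) \<in> Ut k h (next_premium k \<Phi>)"
      using R k h \<omega> by blast
    ultimately show ?thesis unfolding next_premium_def by simp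
  qed
  with R show ?L by (simp add: feasible_def tail_frontier_def)
qed

lemma premiums_iff:
  assumes "\<omega> \<in> space M" "t \<le> T"
  shows "\<phi> \<in> premiums M T \<Psi> Ut t X (hist t \<omega>) \<longleftrightarrow> (\<exists>Z \<Phi>. feasible t X Z \<Phi> \<and> \<phi> = \<Phi> t \<omega>)"
proof -
  have "at_hist M t (\<Phi> t) (hist t \<omega>) = \<Phi> t \<omega>" if "feasible t X Z \<Phi>" for Z \<Phi>
    using that assms by (intro at_hist_hist strategiesD) (auto simp: feasible_iff)
  then show ?thesis unfolding premiums_def feasible_def by (auto, metis)
qed

section \<open>The risk measure as a minimum attained at all histories at once\<close>

lemma risk_measure_minimum:
  assumes "t \<le> T" "X \<in> payoffs M t T" "hist t \<omega> \<in> histories M t"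
  shows "is_minimum (premiums M T \<Psi> Ut t X (hist t \<omega>)) (\<rho> t X \<omega>)"
proof -
  obtain m where m: "is_minimum (premiums M T \<Psi> Ut t X (hist t \<omega>)) m"
    using minima assms unfolding minima_exist_def by blast
  have "(THE m. is_minimum (premiums M T \<Psi> Ut t X (hist t \<omega>)) m) = m"
    using m by (intro the_equality) (auto intro: is_minimum_unique)
  with m assms show ?thesis by (simp add: risk_measure_def)
qed

text \<open>The value reads the trajectory only through \<open>hist t\<close>; this covers null
  histories too, where \<open>THE\<close> may be unspecified.\<close>

lemma risk_measure_Linf: "t \<le> T + 1 \<Longrightarrow> \<rho> t X \<in> Linf M t"
proof (cases "t = T + 1")
  case True
  then show ?thesis using terminal by (simp add: risk_measure_def)
next
  case False
  then show ?thesis by (simp add: risk_measure_def Linf_iff)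
qed

lemma risk_measure_le:
  assumes "feasible t X Z \<Phi>" "t \<le> T" "\<omega> \<in> space M" "hist t \<omega> \<in> histories M t"
  shows "\<rho> t X \<omega> \<le> \<Phi> t \<omega>"
proof -
  have "\<Phi> t \<omega> \<in> premiums M T \<Psi> Ut t X (hist t \<omega>)"
    using assms premiums_iff by blast
  moreover have "X \<in> payoffs M t T"
    using assms(1) by (simp add: feasible_iff)
  ultimately show ?thesis
    using risk_measure_minimum[OF assms(2) _ assms(4)] unfolding is_minimum_def by blast
qed

text \<open>At each trajectory the current pair is taken whole from one of the two strategies, so it
  satisfies that strategy's constraint. The next premium only decreases, which by antimonotonicity
  enlarges the admissible set.\<close>

lemma feasible_min:
  assumes 1: "feasible t X Z \<Phi>" and 2: "feasible t X Z' \<Phi>'"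
  shows "feasible t X (\<lambda>k\<in>{t..T}. \<lambda>\<omega>. if \<Phi> k \<omega> \<le> \<Phi>' k \<omega> then Z k \<omega> else Z' k \<omega>)
    (\<lambda>k\<in>{t..T}. \<lambda>\<omega>. min (\<Phi> k \<omega>) (\<Phi>' k \<omega>))" (is "feasible t X ?Z ?\<Phi>")
proof -
  note str = 1[unfolded feasible_iff] 2[unfolded feasible_iff]
  \<comment> \<open>The comparison of premiums depends only on the history up to \<open>k\<close>,
    so the selection stays measurable.\<close>
  have "(\<lambda>\<omega>. if \<Phi> k \<omega> \<le> \<Phi>' k \<omega> then Z k \<omega> else Z' k \<omega>) \<in> Linf M k"
    "(\<lambda>\<omega>. min (\<Phi> k \<omega>) (\<Phi>' k \<omega>)) \<in> Linf M k" if "k \<in> {t..T}" for k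
    using that str strategiesD[of _ t k] unfolding Linf_iff by smt+
  then have Z: "?Z \<in> strategies M t T" and \<Phi>: "?\<Phi> \<in> strategies M t T"
    by (auto simp: strategies_def)
  have "(cond_rv k (X k) (hist k \<omega>), ?Z k \<omega>, ?\<Phi> k \<omega>) \<in> Ut k (hist k \<omega>) (next_premium k ?\<Phi>)"
    if k: "k \<in> {t..T}" and \<omega>: "\<omega> \<in> space M" "hist k \<omega> \<in> histories M k" for k \<omega>
  proof -
    have "le_as M (next_premium k ?\<Phi>) (next_premium k \<Phi>)"
      "le_as M (next_premium k ?\<Phi>) (next_premium k \<Phi>')"
      using k by (auto simp: next_premium_def le_as_def)
    then have "Ut k (hist k \<omega>) (next_premium k \<Phi>) \<subseteq> Ut k (hist k \<omega>) (next_premium k ?\<Phi>)"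
      "Ut k (hist k \<omega>) (next_premium k \<Phi>') \<subseteq> Ut k (hist k \<omega>) (next_premium k ?\<Phi>)"
      using antimono_premium[OF _ \<omega>(2) next_premium_Linf[OF \<Phi> k] next_premium_Linf[OF _ k]] k str
      by auto
    moreover have "(cond_rv k (X k) (hist k \<omega>), Z k \<omega>, \<Phi> k \<omega>) \<in> Ut k (hist k \<omega>) (next_premium k \<Phi>)"
      "(cond_rv k (X k) (hist k \<omega>), Z' k \<omega>, \<Phi>' k \<omega>) \<in> Ut k (hist k \<omega>) (next_premium k \<Phi>')"
      using str k \<omega> by blast+
    ultimately show ?thesis using k by (auto simp: min_def)
  qed
  with str Z \<Phi> show ?thesis by (simp add: feasible_iff)
qed

text \<open>Induction on \<open>H\<close>, merging pairs by \<open>feasible_min\<close>: the smaller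
  premium obeys the bound wherever either premium does. Only an upper bound is carried along because
  it survives the minimum; \<open>risk_measure_le\<close> later turns it into equality.\<close>

lemma optimal_on_finite:
  assumes "t \<le> T" "X \<in> payoffs M t T" "finite H" "H \<noteq> {}" "H \<subseteq> histories M t"
  shows "\<exists>Z \<Phi>. feasible t X Z \<Phi> \<and> (\<forall>\<omega>\<in>space M. hist t \<omega> \<in> H \<longrightarrow> \<Phi> t \<omega> \<le> \<rho> t X \<omega>)"
proof -
  have single: "\<exists>Z \<Phi>. feasible t X Z \<Phi> \<and> (\<forall>\<omega>\<in>space M. hist t \<omega> = h \<longrightarrow> \<Phi> t \<omega> \<le> \<rho> t X \<omega>)"
    if h: "h \<in> histories M t" for h
  proof -
    obtain \<omega> where \<omega>: "\<omega> \<in> space M" "hist t \<omega> = h" using h by (rule histories_obtain)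
    have "\<rho> t X \<omega> \<in> premiums M T \<Psi> Ut t X (hist t \<omega>)"
      using risk_measure_minimum[OF assms(1,2), of \<omega>] h \<omega> by (simp add: is_minimum_def)
    then obtain Z \<Phi> where F: "feasible t X Z \<Phi>" "\<rho> t X \<omega> = \<Phi> t \<omega>"
      using premiums_iff \<omega> assms(1) by blast
    then have "\<Phi> t \<in> Linf M t" using assms(1) strategiesD[of \<Phi> t t] by (auto simp: feasible_iff)
    moreover have "\<rho> t X \<in> Linf M t" using assms(1) by (intro risk_measure_Linf) simp
    \<comment> \<open>Attainment at one trajectory extends to its whole fibre, since both sides are
      determined by the history.\<close>
    ultimately have "\<Phi> t \<omega>' = \<rho> t X \<omega>'" if "\<omega>' \<in> space M" "hist t \<omega>' = h" for \<omega>'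
      using that \<omega> F(2) Linf_const by metis
    with F(1) show ?thesis by (intro exI[of _ Z] exI[of _ \<Phi>]) auto
  qed
  show ?thesis
    using assms(3-5)
  proof (induction H rule: finite_ne_induct)
    case (singleton h)
    then show ?case using single[of h] by simp
  next
    case (insert h H)
    then obtain Z \<Phi> where 1: "feasible t X Z \<Phi>"
      "\<forall>\<omega>\<in>space M. hist t \<omega> \<in> H \<longrightarrow> \<Phi> t \<omega> \<le> \<rho> t X \<omega>" by auto
    obtain Z' \<Phi>' where 2: "feasible t X Z' \<Phi>'"
      "\<forall>\<omega>\<in>space M. hist t \<omega> = h \<longrightarrow> \<Phi>' t \<omega> \<le> \<rho> t X \<omega>" using single[of h] insert.prems by auto
    show ?case
      by (rule exI, rule exI, rule conjI[OF feasible_min[OF 1(1) 2(1)]])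
        (use 1(2) 2(2) assms(1) in \<open>auto simp: min_le_iff_disj\<close>)
  qed
qed

text \<open>The empty tail at \<open>T + 1\<close> is included so that the recursion can treat the
  last period like the others.\<close>

lemma optimal_feasible:
  assumes "t \<le> T + 1" "X \<in> payoffs M t T"
  obtains Z \<Phi> where "feasible t X Z \<Phi>"
    "\<And>\<omega>. t \<le> T \<Longrightarrow> \<omega> \<in> space M \<Longrightarrow> hist t \<omega> \<in> histories M t \<Longrightarrow> \<Phi> t \<omega> = \<rho> t X \<omega>"
proof (cases "t = T + 1")
  case True
  \<comment> \<open>Over the empty index set the only extensional process is constantly
    \<open>undefined\<close>.\<close>
  then have "feasible t X (\<lambda>_. undefined) (\<lambda>_. undefined)"
    using assms by (simp add: feasible_iff strategies_def)
  with True that show ?thesis by auto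
next
  case False
  then have t: "t \<le> T" using assms by simp
  obtain Z \<Phi> where F: "feasible t X Z \<Phi>"
    "\<forall>\<omega>\<in>space M. hist t \<omega> \<in> histories M t \<longrightarrow> \<Phi> t \<omega> \<le> \<rho> t X \<omega>"
    using optimal_on_finite[OF t assms(2) finite_histories histories_nonempty order.refl] by blast
  with risk_measure_le[OF F(1) t] that show ?thesis by (meson order.antisym)
qed

section \<open>The one-step recursion\<close>

lemma feasible_tail:
  assumes "feasible t X Z \<Phi>" "t \<le> t'"
  shows "feasible t' (tail t' T X) (tail t' T Z) (tail t' T \<Phi>)"
proof -
  have "tail t' T Z \<in> strategies M t' T" "tail t' T \<Phi> \<in> strategies M t' T"
    using assms by (auto simp: feasible_iff strategies_def tail_def)
  moreover have "next_premium k (tail t' T \<Phi>) = next_premium k \<Phi>" if "k \<in> {t'..T}" for k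
    using that by (auto simp: next_premium_def tail_def)
  ultimately show ?thesis
    using assms tail_payoffs[of X M t T t'] by (auto simp: feasible_iff tail_def)
qed

text \<open>The tail from \<open>t + 1\<close> is itself feasible, so its first premium is at least
  the risk measure there. Replacing that premium by the smaller risk measure keeps the first step
  admissible.\<close>

lemma feasible_first_step:
  assumes F: "feasible t X Z \<Phi>" and t: "t \<le> T" and \<omega>: "\<omega> \<in> space M" "hist t \<omega> \<in> histories M t"
  shows "(cond_rv t (X t) (hist t \<omega>), Z t \<omega>, \<Phi> t \<omega>)
    \<in> Ut t (hist t \<omega>) (\<rho> (t + 1) (tail (t + 1) T X))"
proof -
  have "le_as M (\<rho> (t + 1) (tail (t + 1) T X)) (next_premium t \<Phi>)"
  proof (cases "t = T")
    \<comment> \<open>In the last period both inputs are the terminal input \<Psi>.\<close>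
    case True
    then show ?thesis by (simp add: next_premium_def risk_measure_def le_as_def)
  next
    case False
    then have "t + 1 \<le> T" using t by simp
    then show ?thesis
      using risk_measure_le[OF feasible_tail[OF F, of "t + 1"]]
      by (intro le_asI[of "t + 1"]) (auto simp: next_premium_def tail_def)
  qed
  moreover have "next_premium t \<Phi> \<in> Linf M (t + 1)"
    using F t by (intro next_premium_Linf) (auto simp: feasible_iff)
  moreover have "\<rho> (t + 1) (tail (t + 1) T X) \<in> Linf M (t + 1)"
    using t by (intro risk_measure_Linf) simp
  moreover have "(cond_rv t (X t) (hist t \<omega>), Z t \<omega>, \<Phi> t \<omega>) \<in> Ut t (hist t \<omega>) (next_premium t \<Phi>)"
    using F t \<omega> by (auto simp: feasible_iff)
  ultimately show ?thesis using antimono_premium t \<omega> by blast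
qed

text \<open>Converse of \<open>feasible_first_step\<close>: an admissible step at one history is put
  in front of an optimal tail from \<open>t + 1\<close>. Optimality at all histories matters because
  the correspondence sees the next premium as a whole.\<close>

lemma first_step_premium:
  assumes t: "t \<le> T" and X: "X \<in> payoffs M t T"
    and \<omega>: "\<omega> \<in> space M" "hist t \<omega> \<in> histories M t"
    and step: "(cond_rv t (X t) (hist t \<omega>), z, \<phi>)
      \<in> Ut t (hist t \<omega>) (\<rho> (t + 1) (tail (t + 1) T X))"
  shows "\<phi> \<in> premiums M T \<Psi> Ut t X (hist t \<omega>)"
proof -
  let ?X = "tail (t + 1) T X"
  obtain Z \<Phi> where F: "feasible (t + 1) ?X Z \<Phi>"
    and opt: "\<And>\<omega>. t + 1 \<le> T \<Longrightarrow> \<omega> \<in> space M \<Longrightarrow> hist (t + 1) \<omega> \<in> histories M (t + 1) \<Longrightarrow>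
      \<Phi> (t + 1) \<omega> = \<rho> (t + 1) ?X \<omega>"
    using t tail_payoffs[OF X] by (auto intro: optimal_feasible[of "t + 1" ?X])
  \<comment> \<open>A feasible pair from period \<open>t\<close>, wanted only for its values in
    period \<open>t\<close> at the other histories.\<close>
  have "t \<le> T + 1" using t by simp
  then obtain Z0 \<Phi>0 where F0: "feasible t X Z0 \<Phi>0"
    by (rule optimal_feasible[OF _ X]) (blast intro: that)
  define Z1 where "Z1 = Z(t := \<lambda>\<omega>'. if hist t \<omega>' = hist t \<omega> then z else Z0 t \<omega>')"
  define \<Phi>1 where "\<Phi>1 = \<Phi>(t := \<lambda>\<omega>'. if hist t \<omega>' = hist t \<omega> then \<phi> else \<Phi>0 t \<omega>')"
  have interval: "{t..T} = insert t {t + 1..T}" using t by auto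
  have "Z0 t \<in> Linf M t" "\<Phi>0 t \<in> Linf M t"
    using F0 t by (auto simp: feasible_iff intro: strategiesD)
  then have "Z1 t \<in> Linf M t" "\<Phi>1 t \<in> Linf M t"
    unfolding Z1_def \<Phi>1_def fun_upd_same Linf_iff by metis+
  then have str: "Z1 \<in> strategies M t T" "\<Phi>1 \<in> strategies M t T"
    using F unfolding strategies_def interval feasible_iff Z1_def \<Phi>1_def
    by (simp_all only: PiE_fun_upd fun_upd_same)
  have next1: "next_premium k \<Phi>1 = next_premium k \<Phi>" if "k \<ge> t" for k
    using that by (simp add: next_premium_def \<Phi>1_def)
  \<comment> \<open>The tail premium agrees with the risk measure at every history of positive
    probability, so antimonotonicity transfers admissibility from the risk measure to the actual
    next premium.\<close>
  have "le_as M (next_premium t \<Phi>1) (\<rho> (t + 1) ?X)"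
  proof (cases "t = T")
    case True
    then show ?thesis by (simp add: next_premium_def risk_measure_def le_as_def)
  next
    case False
    then show ?thesis
      using t opt by (intro le_asI[of "t + 1"]) (simp_all add: next_premium_def \<Phi>1_def)
  qed
  then have sub: "Ut t h (\<rho> (t + 1) ?X) \<subseteq> Ut t h (next_premium t \<Phi>1)" if "h \<in> histories M t" for h
    using antimono_premium[OF t that next_premium_Linf[OF str(2)] risk_measure_Linf] t by simp
  have "(cond_rv k (X k) (hist k \<omega>'), Z1 k \<omega>', \<Phi>1 k \<omega>') \<in> Ut k (hist k \<omega>') (next_premium k \<Phi>1)"
    if k: "k \<in> {t..T}" and \<omega>': "\<omega>' \<in> space M" "hist k \<omega>' \<in> histories M k" for k \<omega>'
  proof (cases "k = t")
    case True
    \<comment> \<open>On the chosen history this is the given step; elsewhere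
      \<open>feasible_first_step\<close> makes the borrowed values admissible for the same
      input.\<close>
    have "(cond_rv t (X t) (hist t \<omega>'), Z1 t \<omega>', \<Phi>1 t \<omega>') \<in> Ut t (hist t \<omega>') (\<rho> (t + 1) ?X)"
      using step feasible_first_step[OF F0 t \<omega>'(1)] \<omega>' True by (simp add: Z1_def \<Phi>1_def)
    with sub \<omega>' True show ?thesis by blast
  next
    case False
    with k have k': "k \<in> {t + 1..T}" "?X k = X k" by (auto simp: tail_def)
    with F \<omega>' have "(cond_rv k (X k) (hist k \<omega>'), Z k \<omega>', \<Phi> k \<omega>')
        \<in> Ut k (hist k \<omega>') (next_premium k \<Phi>)"
      unfolding feasible_iff by metis
    moreover have "Z1 k = Z k" "\<Phi>1 k = \<Phi> k" using False by (simp_all add: Z1_def \<Phi>1_def)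
    ultimately show ?thesis using k by (simp add: next1)
  qed
  with X str have "feasible t X Z1 \<Phi>1" by (simp add: feasible_iff)
  moreover have "\<Phi>1 t \<omega> = \<phi>" by (simp add: \<Phi>1_def)
  ultimately show ?thesis using premiums_iff[OF \<omega>(1) t] by blast
qed

text \<open>By the two preceding lemmas, full tails and single steps reach the same set of current
  premiums, so the minimum is the same and its existence carries over.\<close>

lemma risk_measure_recursion:
  assumes t: "t \<le> T" and X: "X \<in> payoffs M t T" and \<omega>: "\<omega> \<in> space M" "hist t \<omega> \<in> histories M t"
  shows "is_minimum {\<phi>. \<exists>z. (cond_rv t (X t) (hist t \<omega>), z, \<phi>)
      \<in> Ut t (hist t \<omega>) (\<rho> (t + 1) (tail (t + 1) T X))} (\<rho> t X \<omega>)"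
proof -
  have "premiums M T \<Psi> Ut t X (hist t \<omega>) = {\<phi>. \<exists>z. (cond_rv t (X t) (hist t \<omega>), z, \<phi>)
      \<in> Ut t (hist t \<omega>) (\<rho> (t + 1) (tail (t + 1) T X))}"
    using first_step_premium[OF t X \<omega>] feasible_first_step[OF _ t \<omega>, of X]
    by (auto simp: premiums_iff[OF \<omega>(1) t] simp del: split_paired_Ex) blast
  with risk_measure_minimum[OF t X \<omega>(2)] show ?thesis by simp
qed

section \<open>Monotonicity of one step and time consistency\<close>

lemma risk_measure_step_mono:
  assumes t: "t \<le> T" and X: "X \<in> payoffs M t T" and Y: "Y \<in> payoffs M t T"
    and eq: "eq_as M (X t) (Y t)"
    and le: "le_as M (\<rho> (t + 1) (tail (t + 1) T X)) (\<rho> (t + 1) (tail (t + 1) T Y))"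
  shows "le_as M (\<rho> t X) (\<rho> t Y)"
proof (rule le_asI[of t])
  fix \<omega> assume \<omega>: "\<omega> \<in> space M" "hist t \<omega> \<in> histories M t"
  let ?h = "hist t \<omega>"
  have "le_as M (cond_rv t (Y t) ?h) (cond_rv t (X t) ?h)"
    using eq unfolding eq_as_def le_as_def cond_rv_def by eventually_elim simp
  moreover have L: "X t \<in> Linf M (t + 1)" "Y t \<in> Linf M (t + 1)"
    using X Y t by (auto intro!: payoffsD[of _ t, simplified])
  moreover have R: "\<rho> (t + 1) X' \<in> Linf M (t + 1)" for X'
    using t by (intro risk_measure_Linf) simp
  \<comment> \<open>Antimonotonicity replaces the next input of \<open>Y\<close> by the smaller one
    of \<open>X\<close>; payoff monotonicity then replaces the payoff. Hence the minimum for
    \<open>X\<close> runs over a larger set.\<close>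
  ultimately have "(cond_rv t (X t) ?h, z, \<phi>) \<in> Ut t ?h (\<rho> (t + 1) (tail (t + 1) T X))"
    if "(cond_rv t (Y t) ?h, z, \<phi>) \<in> Ut t ?h (\<rho> (t + 1) (tail (t + 1) T Y))" for z \<phi>
    using that antimono_premium[OF t \<omega>(2) R R le]
      mono_payoff[OF t \<omega>(2) R cond_rv_Linf[OF L(2)] cond_rv_Linf[OF L(1)]] by blast
  then show "\<rho> t X \<omega> \<le> \<rho> t Y \<omega>"
    by (intro is_minimum_antimono[OF risk_measure_recursion[OF t X \<omega>] risk_measure_recursion[OF t Y \<omega>]])
      blast
qed

lemma time_consistent_risk_measure: "time_consistent M T \<rho>"
  unfolding time_consistent_def
proof (intro allI impI ballI)
  fix t1 t2 X Y
  assume t: "t1 < t2 \<and> t2 \<le> T" and X: "X \<in> payoffs M t1 T" and Y: "Y \<in> payoffs M t1 T"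
    and *: "(\<forall>k\<in>{t1..<t2}. eq_as M (X k) (Y k)) \<and> le_as M (\<rho> t2 (tail t2 T X)) (\<rho> t2 (tail t2 T Y))"
  have "t1 \<le> t2" using t by simp
  \<comment> \<open>Writing tails also at \<open>t1\<close> gives the claim the same form at every
    period, for the induction descending from \<open>t2\<close>.\<close>
  then have "le_as M (\<rho> t1 (tail t1 T X)) (\<rho> t1 (tail t1 T Y))"
  proof (induction rule: inc_induct)
    case base
    then show ?case using * by simp
  next
    case (step k)
    have "eq_as M (X k) (Y k)" using * step by simp
    moreover have "tail k T W k = W k" for W :: "('s, 'x) process"
      using step t by (simp add: tail_def)
    ultimately show ?case
      using step t
      by - (rule risk_measure_step_mono[OF _ tail_payoffs[OF X] tail_payoffs[OF Y]],
        simp_all add: tail_tail)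
  qed
  then show "le_as M (\<rho> t1 X) (\<rho> t1 Y)" using X Y by (simp add: tail_payoffs_same)
qed

end

theorem theorem18:
  fixes s0 :: "'s::finite" and T :: nat
    and M :: "('s, 'x::finite) traj measure"
    and U :: "(('s, 'x) process \<times> ('s, 'x) process \<times> ('s, 'x) process) set"
    and \<Psi> :: "('s, 'x) rv"
    and Ut :: "('s, 'x) correspondence"
  assumes model: "scenario_model s0 T M"
    and frontier: "risk_frontier M T U"
    and terminal: "\<Psi> \<in> Linf M (T + 1)"
    and corr: "correspondences M T Ut"
    and decomp: "U = tail_frontier M T \<Psi> Ut 0"
    and mono_payoff: "\<And>t h \<Phi> X X' z \<phi>. \<lbrakk>t \<le> T; h \<in> histories M t; \<Phi> \<in> Linf M (t + 1);
        X \<in> Linf M (t + 1); X' \<in> Linf M (t + 1);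
        (X, z, \<phi>) \<in> Ut t h \<Phi>; le_as M X X'\<rbrakk> \<Longrightarrow> (X', z, \<phi>) \<in> Ut t h \<Phi>"
    and antimono_premium: "\<And>t h \<Phi> \<Phi>'. \<lbrakk>t \<le> T; h \<in> histories M t;
        \<Phi> \<in> Linf M (t + 1); \<Phi>' \<in> Linf M (t + 1); le_as M \<Phi> \<Phi>'\<rbrakk> \<Longrightarrow> Ut t h \<Phi>' \<subseteq> Ut t h \<Phi>"
    and minima: "minima_exist M T \<Psi> Ut"
  shows "(\<forall>t\<le>T. \<forall>X\<in>payoffs M t T. \<forall>h\<in>histories M t.
            is_minimum
              {\<phi>. \<exists>z. (cond_rv t (X t) h, z, \<phi>)
                 \<in> Ut t h (risk_measure M T \<Psi> Ut (t + 1) (tail (t + 1) T X))}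
              (at_hist M t (risk_measure M T \<Psi> Ut t X) h))
       \<and> time_consistent M T (risk_measure M T \<Psi> Ut)"
proof -
  interpret decomposed_frontier s0 T M \<Psi> Ut
    using model terminal mono_payoff antimono_premium minima by unfold_locales
  have "is_minimum
      {\<phi>. \<exists>z. (cond_rv t (X t) h, z, \<phi>) \<in> Ut t h (\<rho> (t + 1) (tail (t + 1) T X))}
      (at_hist M t (\<rho> t X) h)"
    if t: "t \<le> T" and X: "X \<in> payoffs M t T" and h: "h \<in> histories M t" for t X h
  proof -
    obtain \<omega> where \<omega>: "\<omega> \<in> space M" "hist t \<omega> = h" using h by (rule histories_obtain)
    \<comment> \<open>Return from trajectories to histories: any trajectory through \<open>h\<close>
      represents the value there.\<close>
    have "at_hist M t (\<rho> t X) h = \<rho> t X \<omega>"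
      using at_hist_hist[OF risk_measure_Linf \<omega>(1)] t \<omega>(2) by auto
    with risk_measure_recursion[OF t X \<omega>(1)] h \<omega>(2) show ?thesis by simp
  qed
  with time_consistent_risk_measure show ?thesis by blast
qed

end
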